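(* Let $\mathcal{I}$ be an ideal on $\omega$ and fix $f\in\ell_\infty^{\,\prime}$. Then there exist $g,h\in\mathrm{SL}(\mathcal{I})$ such that $f=g-h$ if and only if the following conditions hold: (a) $f(e)=0$; (b) $\|f\|\le 2$; (c) $f(\bm{1}_A)=0$ for all $A\in\mathcal{I}$. In addition, when these conditions hold, such a decomposition (that is, the pair $(g,h)\in\mathrm{SL}(\mathcal{I})^2$ with $f=g-h$) is unique if and only if $\|f\|=2$ or $\mathcal{I}$ is maximal.
   Context: $\omega$ is the set of nonnegative integers. An ideal on $\omega$ is a family $\mathcal{I}\subseteq\mathcal{P}(\omega)$ closed under finite unions and subsets, with $\omega\notin\mathcal{I}$ and containing all finite subsets of $\omega$; it is maximal if it is maximal with respect to inclusion among such families. $\ell_\infty$ is the Banach lattice of bounded real sequences with the supremum norm and pointwise order, $\ell_\infty^{\,\prime}$ its norm dual with the dual norm $\|\cdot\|$; $e:=(1,1,\ldots)$; $c$ is the space of convergent real sequences; $\bm{1}_A$ is the characteristic sequence of $A\subseteq\omega$. $\mathrm{SL}(\mathcal{I})$ is the set of linear functionals $f:\ell_\infty\to\mathbf{R}$ such that: (i) $f(x)\ge 0$ whenever $x\ge 0$; (ii) $f(x)=\lim x$ for all $x\in c$; (iii) $f(\bm{1}_A)=0$ for all $A\in\mathcal{I}$. (Such functionals are automatically continuous.) *)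

theory Defs
  imports "HOL-Analysis.Analysis"
begin

text \<open>The topology of \<^typ>\<open>nat\<close> is discrete, so the bounded continuous functions on \<^typ>\<open>nat\<close>,
  with their supremum norm, are exactly the Banach space of bounded real sequences. Its norm dual is
  the type of bounded linear maps to \<^typ>\<open>real\<close>, normed by the operator norm.\<close>

type_synonym ell_infty = "nat \<Rightarrow>\<^sub>C real"

type_synonym ell_infty_dual = "ell_infty \<Rightarrow>\<^sub>L real"

definition char_seq :: "nat set \<Rightarrow> ell_infty" where
  "char_seq A = Bcontfun (indicat_real A)"

lemma apply_char_seq [simp]: "apply_bcontfun (char_seq A) = indicat_real A"
proof -
  have "norm (indicat_real A n) \<le> 1" for n
    by (simp add: indicator_def)
  then have "indicat_real A \<in> bcontfun"
    by (intro bcontfun_normI Topological_Spaces.continuous_on_discrete)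
  then show ?thesis
    by (simp add: char_seq_def Bcontfun_inverse)
qed

definition ideal_on_nat :: "nat set set \<Rightarrow> bool" where
  "ideal_on_nat I \<longleftrightarrow>
     (\<forall>A\<in>I. \<forall>B\<in>I. A \<union> B \<in> I) \<and>
     (\<forall>A\<in>I. \<forall>B. B \<subseteq> A \<longrightarrow> B \<in> I) \<and>
     UNIV \<notin> I \<and>
     (\<forall>A. finite A \<longrightarrow> A \<in> I)"

definition maximal_ideal_on_nat :: "nat set set \<Rightarrow> bool" where
  "maximal_ideal_on_nat I \<longleftrightarrow>
     ideal_on_nat I \<and> (\<forall>J. ideal_on_nat J \<longrightarrow> I \<subseteq> J \<longrightarrow> J = I)"

text \<open>The members are plain linear functionals: their continuity is a consequence, not a
  requirement.\<close>

definition SL :: "nat set set \<Rightarrow> (ell_infty \<Rightarrow> real) set" where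
  "SL I = {f. linear f \<and>
     (\<forall>x. (\<forall>n. 0 \<le> apply_bcontfun x n) \<longrightarrow> 0 \<le> f x) \<and>
     (\<forall>x. convergent (apply_bcontfun x) \<longrightarrow> f x = lim (apply_bcontfun x)) \<and>
     (\<forall>A\<in>I. f (char_seq A) = 0)}"

end

theory Submission
  imports Defs
begin

text \<open>
  Write \<open>e\<close> for the constant sequence \<open>1\<close>. A positive linear functional \<open>p\<close> satisfies
  \<open>\<bar>p x\<bar> \<le> \<parallel>x\<parallel> p e\<close>, so a difference of two members of \<open>SL I\<close>, which both take the value \<open>1\<close>
  at \<open>e\<close>, has norm at most \<open>2\<close>; this gives the easy direction.

  For the converse, split \<open>f = f\<^sup>+ - f\<^sup>-\<close> as in the theory of Riesz spaces, where
  \<open>f\<^sup>+ x\<close> is the supremum of \<open>f y\<close> over \<open>0 \<le> y \<le> x\<close> when \<open>x \<ge> 0\<close>. As \<open>f e = 0\<close>, both parts have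
  the same value at \<open>e\<close>, and the substitution \<open>y \<mapsto> 2 y - e\<close>, which carries the order interval
  \<open>[0, e]\<close> onto the unit ball, identifies this value as \<open>\<parallel>f\<parallel> / 2\<close> (\<open>norm_eq_pos_part\<close>). Both parts
  still vanish on the indicators of sets in \<open>I\<close> (\<open>pos_part_null\<close>). What they lack to the value
  \<open>1\<close> at \<open>e\<close> is supplied by any \<open>s \<in> SL I\<close>: the functionals
  \<open>f\<^sup>+ + (1 - \<parallel>f\<parallel> / 2) s\<close> and \<open>f\<^sup>- + (1 - \<parallel>f\<parallel> / 2) s\<close> are positive, take the value \<open>1\<close> at
  \<open>e\<close>, vanish on \<open>I\<close>, and differ by \<open>f\<close>. These three properties already force agreement with the
  limit on convergent sequences (\<open>positive_linear_in_SL\<close>), because \<open>I\<close> contains the finite sets.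

  Uniqueness is now a matter of how much room the filling \<open>s\<close> leaves. If \<open>\<parallel>f\<parallel> < 2\<close>, different
  choices of \<open>s\<close> give different decompositions, and there are different choices as soon as \<open>I\<close> is
  not maximal: a set \<open>A\<close> in a strictly larger ideal but not in \<open>I\<close> has complement outside \<open>I\<close>
  too, and for each set outside \<open>I\<close> some \<open>s \<in> SL I\<close> has the value \<open>1\<close> on it
  (\<open>SL_with_value_one\<close>, by compactness). If \<open>I\<close> is maximal, each member of \<open>SL I\<close> is \<open>0\<close> or \<open>1\<close> on
  every indicator, as \<open>I\<close> dictates, so \<open>SL I\<close> has only one element. If \<open>\<parallel>f\<parallel> = 2\<close>, then every
  decomposition \<open>f = g - h\<close> has \<open>g - f\<^sup>+ \<ge> 0\<close> with value \<open>1 - \<parallel>f\<parallel> / 2 = 0\<close> at \<open>e\<close>, which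
  forces \<open>g = f\<^sup>+\<close>.
\<close>

section \<open>Bounded sequences\<close>

abbreviation unit_seq :: ell_infty where
  "unit_seq \<equiv> const_bcontfun 1"

abbreviation seq_le :: "ell_infty \<Rightarrow> ell_infty \<Rightarrow> bool" (infix "\<preceq>" 50) where
  "x \<preceq> y \<equiv> \<forall>n. apply_bcontfun x n \<le> apply_bcontfun y n"

definition positive_linear :: "(ell_infty \<Rightarrow> real) \<Rightarrow> bool" where
  "positive_linear p \<longleftrightarrow> linear p \<and> (\<forall>x. 0 \<preceq> x \<longrightarrow> 0 \<le> p x)"

lemma apply_Bcontfun_bounded:
  fixes u :: "nat \<Rightarrow> real"
  assumes "\<And>n. \<bar>u n\<bar> \<le> b"
  shows "apply_bcontfun (Bcontfun u) = u"
  using assms by (intro Bcontfun_inverse bcontfun_normI Topological_Spaces.continuous_on_discrete) auto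

lemma abs_apply_le_norm: "\<bar>apply_bcontfun (x :: ell_infty) n\<bar> \<le> norm x"
  using norm_bounded[of x n] by simp

lemma apply_le_norm: "apply_bcontfun (x :: ell_infty) n \<le> norm x"
  and minus_norm_le_apply: "- norm x \<le> apply_bcontfun (x :: ell_infty) n"
  using abs_apply_le_norm[of x n] by auto

lemma char_seq_UNIV: "char_seq UNIV = unit_seq"
  by (rule bcontfun_eqI) simp

section \<open>Positive functionals\<close>

lemma positive_linear_mono:
  assumes "positive_linear p" and "x \<preceq> y"
  shows "p x \<le> p y"
proof -
  have "0 \<le> p (y - x)"
    using assms by (auto simp: positive_linear_def)
  then show ?thesis
    using assms(1) by (simp add: positive_linear_def linear_diff)
qed

text \<open>This is the continuity of positive functionals, with the norm read off at the unit; in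
  particular a positive functional that vanishes at the unit is zero.\<close>

lemma positive_linear_abs_le:
  assumes p: "positive_linear p"
  shows "\<bar>p x\<bar> \<le> norm x * p unit_seq"
proof -
  have lin: "linear p" using p by (simp add: positive_linear_def)
  have "p x \<le> p (norm x *\<^sub>R unit_seq)"
    by (rule positive_linear_mono[OF p]) (simp add: apply_le_norm)
  moreover have "p (- norm x *\<^sub>R unit_seq) \<le> p x"
    by (rule positive_linear_mono[OF p]) (use minus_norm_le_apply in simp)
  ultimately show ?thesis
    by (simp add: linear_scale[OF lin] abs_le_iff linear_neg[OF lin])
qed

text \<open>A sequence that is at most \<open>\<epsilon>\<close> from some index on is dominated by \<open>\<epsilon>\<close> times the unit plus a
  multiple of the indicator of a finite set, on which \<open>p\<close> vanishes. Applying this to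
  \<open>\<plusminus> (x - lim x)\<close> shows that \<open>p\<close> extends the limit.\<close>

lemma positive_linear_in_SL:
  assumes I: "ideal_on_nat I" and p: "positive_linear p"
    and e: "p unit_seq = 1" and null: "\<And>A. A \<in> I \<Longrightarrow> p (char_seq A) = 0"
  shows "p \<in> SL I"
proof -
  have lin: "linear p" using p by (simp add: positive_linear_def)
  have null_seq: "p y \<le> \<epsilon>"
    if \<epsilon>: "\<epsilon> > 0" and tail: "\<And>n. n \<ge> N \<Longrightarrow> apply_bcontfun y n \<le> \<epsilon>" for y \<epsilon> N
  proof -
    have "p y \<le> p (\<epsilon> *\<^sub>R unit_seq + norm y *\<^sub>R char_seq {..<N})"
    proof (rule positive_linear_mono[OF p], intro allI)
      fix n
      show "apply_bcontfun y n
          \<le> apply_bcontfun (\<epsilon> *\<^sub>R unit_seq + norm y *\<^sub>R char_seq {..<N}) n"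
        using tail[of n] apply_le_norm[of y n] \<epsilon> by (cases "n < N") auto
    qed
    also have "\<dots> = \<epsilon>"
      using e null[of "{..<N}"] I
      by (simp add: linear_add[OF lin] linear_scale[OF lin] ideal_on_nat_def)
    finally show ?thesis .
  qed
  have "p x = lim (apply_bcontfun x)" if conv: "convergent (apply_bcontfun x)" for x
  proof -
    define L where "L = lim (apply_bcontfun x)"
    have L: "apply_bcontfun x \<longlonglongrightarrow> L"
      using conv by (simp add: L_def convergent_LIMSEQ_iff)
    have "\<bar>p x - L\<bar> \<le> \<epsilon>" if \<epsilon>: "\<epsilon> > 0" for \<epsilon>
    proof -
      obtain N where N: "\<And>n. n \<ge> N \<Longrightarrow> \<bar>apply_bcontfun x n - L\<bar> < \<epsilon>"
        using LIMSEQ_D[OF L \<epsilon>] by auto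
      have "p (x - L *\<^sub>R unit_seq) \<le> \<epsilon>"
        by (rule null_seq[OF \<epsilon>, of N]) (use N in \<open>fastforce simp: abs_less_iff\<close>)
      moreover have "p (L *\<^sub>R unit_seq - x) \<le> \<epsilon>"
        by (rule null_seq[OF \<epsilon>, of N]) (use N in \<open>fastforce simp: abs_less_iff\<close>)
      ultimately show ?thesis
        by (simp add: linear_diff[OF lin] linear_scale[OF lin] e abs_le_iff)
    qed
    then have "\<bar>p x - L\<bar> \<le> 0"
      by (rule field_le_epsilon) simp
    then show ?thesis by (simp add: L_def)
  qed
  then show ?thesis
    using p null by (auto simp: SL_def positive_linear_def)
qed

lemma SL_D:
  assumes "g \<in> SL I"
  shows SL_positive_linear: "positive_linear g" and SL_unit: "g unit_seq = 1"
    and SL_null: "A \<in> I \<Longrightarrow> g (char_seq A) = 0"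
proof -
  show "positive_linear g" "A \<in> I \<Longrightarrow> g (char_seq A) = 0"
    using assms by (auto simp: SL_def positive_linear_def)
  have "convergent (apply_bcontfun unit_seq)"
    by (simp add: convergent_const)
  then have "g unit_seq = lim (apply_bcontfun unit_seq)"
    using assms unfolding SL_def by blast
  then show "g unit_seq = 1" by simp
qed

section \<open>Functionals determined by indicator sequences\<close>

text \<open>The proof strips binary digits. For \<open>0 \<le> x \<le> 1\<close> and \<open>C\<close> the set where \<open>x > 1/2\<close>, the sequence
  \<open>2 x - 1\<^sub>C\<close> again has values in \<open>[0, 1]\<close> and the same support bound, while \<open>d\<close> takes twice the
  value there. Iterating, a nonzero \<open>d x\<close> would make \<open>d\<close> unbounded on the unit ball.\<close>

lemma vanishing_on_subindicators:
  assumes lin: "linear d" and bound: "\<And>x. \<bar>d x\<bar> \<le> norm x * K"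
    and null: "\<And>C. C \<subseteq> B \<Longrightarrow> d (char_seq C) = 0"
    and x: "0 \<preceq> x" "x \<preceq> char_seq B"
  shows "d x = 0"
proof -
  have step: "\<exists>y. 0 \<preceq> y \<and> y \<preceq> char_seq B \<and> d x = d y / 2"
    if x: "0 \<preceq> x" "x \<preceq> char_seq B" for x
  proof -
    define C where "C = {n. apply_bcontfun x n > 1/2}"
    define y where "y = 2 *\<^sub>R x - char_seq C"
    have "C \<subseteq> B"
    proof
      fix n assume "n \<in> C"
      then show "n \<in> B"
        using x(2)[rule_format, of n] by (cases "n \<in> B") (auto simp: C_def)
    qed
    then have "d y = 2 * d x"
      using null by (simp add: y_def linear_diff[OF lin] linear_scale[OF lin])
    moreover have "0 \<le> apply_bcontfun y n \<and> apply_bcontfun y n \<le> indicat_real B n" for n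
      using x(1)[rule_format, of n] x(2)[rule_format, of n] \<open>C \<subseteq> B\<close>
      by (cases "n \<in> C"; cases "n \<in> B") (auto simp: y_def C_def)
    ultimately show ?thesis by (intro exI[of _ y]) auto
  qed
  have halving: "\<bar>d x\<bar> \<le> \<bar>K\<bar> / 2 ^ k"
    if "0 \<preceq> x" "x \<preceq> char_seq B" for x k
    using that
  proof (induction k arbitrary: x)
    case 0
    have "norm x \<le> 1"
    proof (rule norm_bound)
      fix n
      have "0 \<le> apply_bcontfun x n" "apply_bcontfun x n \<le> indicat_real B n"
        using 0 by auto
      then show "norm (apply_bcontfun x n) \<le> 1"
        by (cases "n \<in> B") auto
    qed
    then have "norm x * \<bar>K\<bar> \<le> 1 * \<bar>K\<bar>"
      by (rule mult_right_mono) simp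
    moreover have "norm x * K \<le> norm x * \<bar>K\<bar>"
      by (rule mult_left_mono) auto
    ultimately show ?case
      using bound[of x] by simp
  next
    case (Suc k)
    then obtain y where "0 \<preceq> y" "y \<preceq> char_seq B" "d x = d y / 2"
      using step by blast
    moreover from this have "\<bar>d y\<bar> \<le> \<bar>K\<bar> / 2 ^ k" by (intro Suc.IH)
    ultimately show ?case by simp
  qed
  have "(\<lambda>k. \<bar>K\<bar> / 2 ^ k) \<longlonglongrightarrow> 0"
    using tendsto_mult_right_zero[OF LIMSEQ_realpow_zero[of "1/2::real"], of "\<bar>K\<bar>"]
    by (simp add: power_one_over)
  then have "\<bar>d x\<bar> \<le> 0"
    using halving[OF x] by (intro LIMSEQ_le_const) auto
  then show ?thesis by simp
qed

lemma functional_eq_zero: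
  assumes lin: "linear d" and bound: "\<And>x. \<bar>d x\<bar> \<le> norm x * K"
    and null: "\<And>C. d (char_seq C) = 0"
  shows "d x = 0"
proof (cases "x = 0")
  case True
  then show ?thesis by (simp add: linear_0[OF lin])
next
  case False
  then have pos: "norm x > 0" by simp
  \<comment> \<open>The normalisation of \<open>x\<close>, carried from the unit ball to the interval from \<open>0\<close> to the unit.\<close>
  define z where "z = (1/2) *\<^sub>R (x /\<^sub>R norm x + unit_seq)"
  have "d z = 0"
  proof (rule vanishing_on_subindicators[OF lin bound null])
    have "0 \<le> norm x + apply_bcontfun x n \<and> apply_bcontfun x n \<le> norm x" for n
      using abs_apply_le_norm[of x n] by linarith
    then show "0 \<preceq> z" "z \<preceq> char_seq UNIV"
      using pos by (auto simp: z_def field_simps)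
  qed
  moreover have "x = (2 * norm x) *\<^sub>R z - norm x *\<^sub>R unit_seq"
    using pos by (intro bcontfun_eqI) (simp add: z_def field_simps)
  ultimately show ?thesis
    using null[of UNIV] by (metis char_seq_UNIV diff_zero lin linear_diff linear_scale scaleR_zero_right)
qed

section \<open>Functionals separating sets outside the ideal\<close>

text \<open>The functional is a limit of evaluations \<open>\<delta> n\<close> along \<open>n \<in> A\<close>, leaving every set of \<open>I\<close>. All
  evaluations lie in the product of the intervals \<open>[- \<parallel>x\<parallel>, \<parallel>x\<parallel>]\<close>, which is compact by Tychonoff's
  theorem, and the sets \<open>\<delta> ` (A - B)\<close> with \<open>B \<in> I\<close> have the finite intersection property because
  \<open>A\<close> is not covered by finitely many members of \<open>I\<close>. A point common to their closures inherits
  from the evaluations every condition that is closed under pointwise limits.\<close>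

lemma SL_with_value_one:
  assumes I: "ideal_on_nat I" and A: "A \<notin> I"
  obtains s where "s \<in> SL I" and "s (char_seq A) = 1"
proof -
  define \<delta> :: "nat \<Rightarrow> ell_infty \<Rightarrow> real" where "\<delta> n = (\<lambda>x. apply_bcontfun x n)" for n
  define U :: "(ell_infty \<Rightarrow> real) set" where "U = Pi\<^sub>E UNIV (\<lambda>x. cball 0 (norm x))"
  have "compactin (product_topology (\<lambda>_. euclidean) UNIV) U"
    by (simp add: U_def compactin_PiE)
  then have U: "compact U"
    by (simp add: euclidean_product_topology)
  have "U \<inter> (\<Inter>B\<in>I. closure (\<delta> ` (A - B))) \<noteq> {}"
  proof (rule compact_imp_fip_image[OF U])
    fix \<B> assume \<B>: "finite \<B>" "\<B> \<subseteq> I"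
    have "\<Union>\<B> \<in> I"
      using \<B> by induction (use I in \<open>auto simp: ideal_on_nat_def\<close>)
    then obtain n where n: "n \<in> A" "n \<notin> \<Union>\<B>"
      using I A unfolding ideal_on_nat_def by blast
    have "\<delta> n \<in> U"
      by (auto simp: U_def \<delta>_def abs_apply_le_norm)
    moreover have "\<delta> n \<in> closure (\<delta> ` (A - B))" if "B \<in> \<B>" for B
      using n that closure_subset by fastforce
    ultimately show "U \<inter> (\<Inter>B\<in>\<B>. closure (\<delta> ` (A - B))) \<noteq> {}"
      by blast
  qed simp
  then obtain s where s: "\<And>B. B \<in> I \<Longrightarrow> s \<in> closure (\<delta> ` (A - B))"
    by blast
  have limit: "s \<in> C" if "closed C" "B \<in> I" "\<And>n. n \<in> A - B \<Longrightarrow> \<delta> n \<in> C" for B C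
    using closure_minimal[of "\<delta> ` (A - B)" C] s[OF that(2)] that by blast
  have empty: "{} \<in> I"
    using I by (simp add: ideal_on_nat_def)
  have "linear s"
  proof (rule linearI)
    show "s (x + y) = s x + s y" for x y
      using limit[of "{t. t (x + y) = t x + t y}", OF _ empty]
      by (simp add: \<delta>_def closed_Collect_eq continuous_on_add)
    show "s (c *\<^sub>R x) = c *\<^sub>R s x" for c x
      using limit[of "{t. t (c *\<^sub>R x) = c *\<^sub>R t x}", OF _ empty]
      by (simp add: \<delta>_def closed_Collect_eq continuous_on_mult_left)
  qed
  moreover have "0 \<le> s x" if "0 \<preceq> x" for x
    using limit[of "{t. 0 \<le> t x}", OF _ empty] that
    by (simp add: \<delta>_def closed_Collect_le)
  ultimately have "positive_linear s"
    by (simp add: positive_linear_def)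
  moreover have "s unit_seq = 1"
    using limit[of "{t. t unit_seq = 1}", OF _ empty]
    by (simp add: \<delta>_def closed_Collect_eq)
  moreover have "s (char_seq B) = 0" if "B \<in> I" for B
    using limit[of "{t. t (char_seq B) = 0}", OF _ that]
    by (simp add: \<delta>_def closed_Collect_eq)
  ultimately have "s \<in> SL I"
    using positive_linear_in_SL[OF I] by blast
  moreover have "s (char_seq A) = 1"
    using limit[of "{t. t (char_seq A) = 1}", OF _ empty]
    by (simp add: \<delta>_def closed_Collect_eq)
  ultimately show thesis by (rule that)
qed

text \<open>If \<open>A\<close> and its complement were both outside \<open>I\<close>, the sets contained in \<open>A\<close> up to a member of
  \<open>I\<close> would form a strictly larger ideal.\<close>

lemma maximal_ideal_dichotomy:
  assumes I: "maximal_ideal_on_nat I"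
  shows "A \<in> I \<or> - A \<in> I"
proof (rule ccontr)
  assume neg: "\<not> (A \<in> I \<or> - A \<in> I)"
  have id: "ideal_on_nat I" using I by (simp add: maximal_ideal_on_nat_def)
  define J where "J = {B. B - A \<in> I}"
  have "ideal_on_nat J"
    unfolding ideal_on_nat_def
  proof (intro conjI ballI allI impI)
    show "B \<union> C \<in> J" if "B \<in> J" "C \<in> J" for B C
      using that id by (auto simp: J_def ideal_on_nat_def Un_Diff)
    show "C \<in> J" if "B \<in> J" "C \<subseteq> B" for B C
      using that id unfolding J_def ideal_on_nat_def by (metis Diff_mono mem_Collect_eq order_refl)
    show "UNIV \<notin> J"
      using neg by (simp add: J_def Compl_eq_Diff_UNIV)
    show "B \<in> J" if "finite B" for B
      using that id by (simp add: J_def ideal_on_nat_def)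
  qed
  moreover have "I \<subseteq> J"
    using id unfolding J_def ideal_on_nat_def by blast
  ultimately have "J = I"
    using I by (simp add: maximal_ideal_on_nat_def)
  moreover have "A \<in> J"
    using id by (simp add: J_def ideal_on_nat_def)
  ultimately show False using neg by simp
qed

lemma SL_maximal_unique:
  assumes I: "maximal_ideal_on_nat I" and s: "s \<in> SL I" and t: "t \<in> SL I"
  shows "s = t"
proof
  fix x
  note P = SL_positive_linear[OF s] SL_positive_linear[OF t]
  then have lin: "linear s" "linear t" by (auto simp: positive_linear_def)
  have compl: "char_seq A = unit_seq - char_seq (- A)" for A
    by (rule bcontfun_eqI) (simp add: indicator_def)
  have "s (char_seq A) = t (char_seq A)" for A
  proof (cases "A \<in> I")
    case True
    then show ?thesis using s t by (simp add: SL_null)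
  next
    case False
    then have "- A \<in> I" using maximal_ideal_dichotomy[OF I] by blast
    then show ?thesis
      using s t by (simp add: compl[of A] linear_diff lin SL_null SL_unit)
  qed
  then have null: "s (char_seq A) - t (char_seq A) = 0" for A
    by simp
  have "s x - t x = 0"
  proof (rule functional_eq_zero[where d = "\<lambda>x. s x - t x" and K = 2])
    show "linear (\<lambda>x. s x - t x)" using lin by (rule linear_compose_sub)
    show "\<bar>s x - t x\<bar> \<le> norm x * 2" for x
      using positive_linear_abs_le[OF P(1), of x] positive_linear_abs_le[OF P(2), of x] s t
      by (simp add: SL_unit)
  qed (rule null)
  then show "s x = t x" by simp
qed

text \<open>The two functionals are separated by a set \<open>A\<close> of a larger ideal: one has the value \<open>1\<close> on \<open>A\<close>,
  the other on its complement.\<close>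

lemma SL_not_maximal_two:
  assumes I: "ideal_on_nat I" and "\<not> maximal_ideal_on_nat I"
  obtains s t where "s \<in> SL I" "t \<in> SL I" "s \<noteq> t"
proof -
  obtain J where J: "ideal_on_nat J" "I \<subseteq> J" "J \<noteq> I"
    using assms by (auto simp: maximal_ideal_on_nat_def)
  then obtain A where A: "A \<in> J" "A \<notin> I" by blast
  have "- A \<notin> I"
  proof
    assume "- A \<in> I"
    then have "A \<union> - A \<in> J"
      using J A unfolding ideal_on_nat_def by blast
    then show False using J(1) by (simp add: ideal_on_nat_def)
  qed
  obtain s where s: "s \<in> SL I" "s (char_seq A) = 1"
    using SL_with_value_one[OF I A(2)] .
  obtain t where t: "t \<in> SL I" "t (char_seq (- A)) = 1"
    using SL_with_value_one[OF I \<open>- A \<notin> I\<close>] .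
  have "char_seq A = unit_seq - char_seq (- A)"
    by (rule bcontfun_eqI) (simp add: indicator_def)
  then have "t (char_seq A) = t unit_seq - t (char_seq (- A))"
    using SL_positive_linear[OF t(1)] by (simp add: positive_linear_def linear_diff)
  then have "t (char_seq A) = 0"
    using t by (simp add: SL_unit)
  with s t show thesis by (intro that[of s t]) auto
qed

section \<open>The positive part of a bounded functional\<close>

definition cone_sup :: "ell_infty_dual \<Rightarrow> ell_infty \<Rightarrow> real" where
  "cone_sup f x = (SUP y\<in>{y. 0 \<preceq> y \<and> y \<preceq> x}. blinfun_apply f y)"

text \<open>The extension of \<open>cone_sup f\<close> from the cone to all sequences: \<open>x\<close> is shifted into the cone by a
  multiple of the unit, whose contribution is then subtracted. The shift by \<open>norm x\<close> is only one
  choice among many (\<open>pos_part_shift\<close>), and this freedom gives additivity.\<close>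

definition pos_part :: "ell_infty_dual \<Rightarrow> ell_infty \<Rightarrow> real" where
  "pos_part f x = cone_sup f (x + norm x *\<^sub>R unit_seq) - norm x * cone_sup f unit_seq"

lemma cone_sup_upper:
  assumes "0 \<preceq> y" "y \<preceq> x"
  shows "blinfun_apply f y \<le> cone_sup f x"
proof -
  have "blinfun_apply f z \<le> norm f * norm x" if z: "0 \<preceq> z" "z \<preceq> x" for z
  proof -
    have "norm z \<le> norm x"
    proof (rule norm_bound)
      fix n
      show "norm (apply_bcontfun z n) \<le> norm x"
        using z(1)[rule_format, of n] z(2)[rule_format, of n] apply_le_norm[of x n] by simp
    qed
    then have "norm f * norm z \<le> norm f * norm x"
      by (simp add: mult_left_mono)
    then show ?thesis
      using norm_blinfun[of f z] by simp
  qed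
  then have "bdd_above (blinfun_apply f ` {y. 0 \<preceq> y \<and> y \<preceq> x})"
    by (intro bdd_aboveI[of _ "norm f * norm x"]) auto
  then show ?thesis
    using assms unfolding cone_sup_def by (intro cSUP_upper) auto
qed

lemma cone_sup_least:
  assumes "0 \<preceq> x" and "\<And>y. 0 \<preceq> y \<Longrightarrow> y \<preceq> x \<Longrightarrow> blinfun_apply f y \<le> b"
  shows "cone_sup f x \<le> b"
proof -
  have "{y. 0 \<preceq> y \<and> y \<preceq> x} \<noteq> {}" using assms(1) by auto
  then show ?thesis
    unfolding cone_sup_def by (rule cSUP_least) (use assms(2) in auto)
qed

lemma cone_sup_nonneg: "0 \<preceq> x \<Longrightarrow> 0 \<le> cone_sup f x"
  using cone_sup_upper[of 0 x f] by (simp add: blinfun.zero_right)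

text \<open>The inequality \<open>\<le>\<close> rests on the Riesz decomposition property: if \<open>0 \<le> z \<le> x + y\<close>, then
  \<open>z = min z x + (z - min z x)\<close> with the summands below \<open>x\<close> and \<open>y\<close>.\<close>

lemma cone_sup_add:
  assumes x: "0 \<preceq> x" and y: "0 \<preceq> y"
  shows "cone_sup f (x + y) = cone_sup f x + cone_sup f y"
proof (rule antisym)
  have xy: "0 \<preceq> x + y" using x y by (simp add: add_nonneg_nonneg)
  show "cone_sup f (x + y) \<le> cone_sup f x + cone_sup f y"
  proof (rule cone_sup_least[OF xy])
    fix z assume z: "0 \<preceq> z" "z \<preceq> x + y"
    define u where "u = Bcontfun (\<lambda>n. min (apply_bcontfun z n) (apply_bcontfun x n))"
    have u: "apply_bcontfun u n = min (apply_bcontfun z n) (apply_bcontfun x n)" for n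
    proof -
      have "\<bar>min (apply_bcontfun z n) (apply_bcontfun x n)\<bar> \<le> norm x" for n
        using z(1)[rule_format, of n] x[rule_format, of n] apply_le_norm[of x n] by auto
      then show ?thesis by (simp add: u_def apply_Bcontfun_bounded[where b = "norm x"])
    qed
    have "blinfun_apply f u \<le> cone_sup f x"
      using z x by (intro cone_sup_upper) (auto simp: u)
    moreover have "blinfun_apply f (z - u) \<le> cone_sup f y"
    proof (rule cone_sup_upper)
      show "0 \<preceq> z - u" by (simp add: u)
      show "z - u \<preceq> y"
      proof
        fix n
        show "apply_bcontfun (z - u) n \<le> apply_bcontfun y n"
          using z(2)[rule_format, of n] y[rule_format, of n] by (auto simp: u)
      qed
    qed
    ultimately show "blinfun_apply f z \<le> cone_sup f x + cone_sup f y"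
      by (simp add: blinfun.diff_right)
  qed
  have add: "blinfun_apply f u + blinfun_apply f v \<le> cone_sup f (x + y)"
    if "0 \<preceq> u" "u \<preceq> x" "0 \<preceq> v" "v \<preceq> y" for u v
    using cone_sup_upper[of "u + v" "x + y" f] that
    by (simp add: blinfun.add_right add_mono)
  have "cone_sup f x \<le> cone_sup f (x + y) - blinfun_apply f v" if "0 \<preceq> v" "v \<preceq> y" for v
    by (rule cone_sup_least[OF x]) (use add that in \<open>simp add: le_diff_eq\<close>)
  then have "cone_sup f y \<le> cone_sup f (x + y) - cone_sup f x"
    by (intro cone_sup_least[OF y]) (simp add: le_diff_eq add.commute)
  then show "cone_sup f x + cone_sup f y \<le> cone_sup f (x + y)" by simp
qed

lemma cone_sup_scale:
  assumes x: "0 \<preceq> x" and c: "c \<ge> 0"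
  shows "cone_sup f (c *\<^sub>R x) = c * cone_sup f x"
proof -
  have le: "cone_sup f (c *\<^sub>R x) \<le> c * cone_sup f x" if c: "c > 0" and x: "0 \<preceq> x" for c x
  proof (rule cone_sup_least)
    show "0 \<preceq> c *\<^sub>R x" using c x by simp
    fix y assume y: "0 \<preceq> y" "y \<preceq> c *\<^sub>R x"
    have "blinfun_apply f (inverse c *\<^sub>R y) \<le> cone_sup f x"
      using c y by (intro cone_sup_upper) (auto simp: field_simps)
    then show "blinfun_apply f y \<le> c * cone_sup f x"
      using c by (simp add: blinfun.scaleR_right field_simps)
  qed
  show ?thesis
  proof (cases "c = 0")
    case True
    then show ?thesis using cone_sup_add[of 0 0 f] by simp
  next
    case False
    with c have c: "c > 0" by simp
    have "cone_sup f (inverse c *\<^sub>R (c *\<^sub>R x)) \<le> inverse c * cone_sup f (c *\<^sub>R x)"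
      using c x by (intro le) auto
    then have "c * cone_sup f x \<le> cone_sup f (c *\<^sub>R x)"
      using c by (simp add: field_simps)
    with le[OF c x] show ?thesis by simp
  qed
qed

lemma pos_part_shift:
  assumes "norm x \<le> t"
  shows "pos_part f x = cone_sup f (x + t *\<^sub>R unit_seq) - t * cone_sup f unit_seq"
proof -
  have "0 \<le> apply_bcontfun x n + norm x" for n
    using minus_norm_le_apply[of x n] by simp
  then have "cone_sup f ((x + norm x *\<^sub>R unit_seq) + (t - norm x) *\<^sub>R unit_seq)
      = cone_sup f (x + norm x *\<^sub>R unit_seq) + cone_sup f ((t - norm x) *\<^sub>R unit_seq)"
    using assms by (intro cone_sup_add) auto
  also have "cone_sup f ((t - norm x) *\<^sub>R unit_seq) = (t - norm x) * cone_sup f unit_seq"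
    using assms by (intro cone_sup_scale) auto
  also have "(x + norm x *\<^sub>R unit_seq) + (t - norm x) *\<^sub>R unit_seq = x + t *\<^sub>R unit_seq"
    by (simp add: scaleR_diff_left)
  finally show ?thesis
    by (simp add: pos_part_def algebra_simps)
qed

lemma shift_nonneg: "norm x \<le> t \<Longrightarrow> 0 \<preceq> x + t *\<^sub>R unit_seq"
proof
  fix n assume "norm x \<le> t"
  then show "apply_bcontfun 0 n \<le> apply_bcontfun (x + t *\<^sub>R unit_seq) n"
    using minus_norm_le_apply[of x n] by simp
qed

lemma pos_part_eq_cone_sup: "0 \<preceq> x \<Longrightarrow> pos_part f x = cone_sup f x"
  by (simp add: pos_part_def cone_sup_add cone_sup_scale)

lemma pos_part_add: "pos_part f (x + y) = pos_part f x + pos_part f y"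
proof -
  have "cone_sup f ((x + norm x *\<^sub>R unit_seq) + (y + norm y *\<^sub>R unit_seq))
      = cone_sup f (x + norm x *\<^sub>R unit_seq) + cone_sup f (y + norm y *\<^sub>R unit_seq)"
    by (intro cone_sup_add shift_nonneg order_refl)
  moreover have "(x + norm x *\<^sub>R unit_seq) + (y + norm y *\<^sub>R unit_seq)
      = (x + y) + (norm x + norm y) *\<^sub>R unit_seq"
    by (simp add: scaleR_add_left)
  moreover have "pos_part f (x + y) = cone_sup f ((x + y) + (norm x + norm y) *\<^sub>R unit_seq)
      - (norm x + norm y) * cone_sup f unit_seq"
    by (rule pos_part_shift) (rule norm_triangle_ineq)
  ultimately show ?thesis
    by (simp add: pos_part_def algebra_simps)
qed

lemma pos_part_scale: "pos_part f (c *\<^sub>R x) = c * pos_part f x"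
proof -
  have nonneg: "pos_part f (c *\<^sub>R x) = c * pos_part f x" if c: "c \<ge> 0" for c x
  proof -
    have "cone_sup f (c *\<^sub>R (x + norm x *\<^sub>R unit_seq)) = c * cone_sup f (x + norm x *\<^sub>R unit_seq)"
      by (intro cone_sup_scale shift_nonneg order_refl c)
    then show ?thesis
      using c by (simp add: pos_part_def algebra_simps)
  qed
  have "pos_part f (x + - x) = pos_part f x + pos_part f (- x)" for x
    by (rule pos_part_add)
  moreover have "pos_part f 0 = 0"
    using nonneg[of 0 0] by simp
  ultimately have minus: "pos_part f (- x) = - pos_part f x" for x
    by (simp add: eq_neg_iff_add_eq_0 add.commute)
  show ?thesis
    using nonneg[of c x] nonneg[of "- c" x] minus[of "c *\<^sub>R x"] by (cases "c \<ge> 0") auto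
qed

lemma pos_part_positive_linear: "positive_linear (pos_part f)"
  unfolding positive_linear_def
  by (auto intro!: linearI simp: pos_part_add pos_part_scale pos_part_eq_cone_sup cone_sup_nonneg)

lemma neg_part_positive_linear: "positive_linear (\<lambda>x. pos_part f x - blinfun_apply f x)"
  unfolding positive_linear_def
proof (intro conjI allI impI)
  show "linear (\<lambda>x. pos_part f x - blinfun_apply f x)"
    using pos_part_positive_linear[of f]
    by (intro linear_compose_sub) (auto simp: positive_linear_def bounded_linear.linear[OF blinfun.bounded_linear_right])
  show "0 \<le> pos_part f x - blinfun_apply f x" if "0 \<preceq> x" for x
    using cone_sup_upper[of x x f] that by (simp add: pos_part_eq_cone_sup)
qed

text \<open>Among the positive functionals that dominate \<open>f\<close> on the cone the positive part is the least, so
  it lies below the first component of every decomposition: \<open>0 \<le> y \<le> x\<close> gives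
  \<open>f y \<le> g y \<le> g x\<close>.\<close>

lemma pos_part_le:
  assumes "positive_linear g" "positive_linear h" "\<And>x. blinfun_apply f x = g x - h x"
    and x: "0 \<preceq> x"
  shows "pos_part f x \<le> g x"
proof -
  have "cone_sup f x \<le> g x"
  proof (rule cone_sup_least[OF x])
    fix y assume "0 \<preceq> y" "y \<preceq> x"
    then have "0 \<le> h y" "g y \<le> g x"
      using assms positive_linear_mono by (auto simp: positive_linear_def)
    then show "blinfun_apply f y \<le> g x" using assms(3) by simp
  qed
  then show ?thesis using x by (simp add: pos_part_eq_cone_sup)
qed

text \<open>Since \<open>f\<close> vanishes at the unit \<open>e\<close>, its two parts agree there, which bounds \<open>\<parallel>f\<parallel>\<close> by twice
  this value. Conversely, if \<open>0 \<le> z \<le> e\<close> then \<open>2 z - e\<close> lies in the unit ball and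
  \<open>f (2 z - e) = 2 f z\<close>.\<close>

lemma norm_eq_pos_part:
  assumes f0: "blinfun_apply f unit_seq = 0"
  shows "norm f = 2 * pos_part f unit_seq"
proof (rule antisym)
  let ?P = "pos_part f unit_seq"
  show "norm f \<le> 2 * ?P"
  proof (rule norm_blinfun_bound)
    show "0 \<le> 2 * ?P"
      using pos_part_positive_linear[of f] by (simp add: positive_linear_def)
    show "norm (blinfun_apply f x) \<le> 2 * ?P * norm x" for x
      using positive_linear_abs_le[OF pos_part_positive_linear, of f x]
        positive_linear_abs_le[OF neg_part_positive_linear, of f x] f0
      by (simp add: algebra_simps)
  qed
  have "cone_sup f unit_seq \<le> norm f / 2"
  proof (rule cone_sup_least)
    fix z assume z: "0 \<preceq> z" "z \<preceq> unit_seq"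
    have "norm (2 *\<^sub>R z - unit_seq) \<le> 1"
    proof (rule norm_bound)
      fix n
      show "norm (apply_bcontfun (2 *\<^sub>R z - unit_seq) n) \<le> 1"
        using z(1)[rule_format, of n] z(2)[rule_format, of n] by (simp add: abs_le_iff)
    qed
    then have "norm f * norm (2 *\<^sub>R z - unit_seq) \<le> norm f"
      by (simp add: mult_left_le)
    moreover have "blinfun_apply f (2 *\<^sub>R z - unit_seq) = 2 * blinfun_apply f z"
      by (simp add: blinfun.diff_right blinfun.scaleR_right f0)
    ultimately show "blinfun_apply f z \<le> norm f / 2"
      using norm_blinfun[of f "2 *\<^sub>R z - unit_seq"] by simp
  qed simp
  then show "2 * ?P \<le> norm f"
    by (simp add: pos_part_eq_cone_sup)
qed

text \<open>The supremum that defines \<open>f\<^sup>+\<close> at an indicator runs over all sequences below it and not only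
  over indicators, so the vanishing of \<open>f\<close> on subsets of \<open>A\<close> must first be spread to these.\<close>

lemma pos_part_null:
  assumes I: "ideal_on_nat I" and null: "\<And>A. A \<in> I \<Longrightarrow> blinfun_apply f (char_seq A) = 0"
    and A: "A \<in> I"
  shows "pos_part f (char_seq A) = 0"
proof -
  have nonneg: "0 \<preceq> char_seq A" by simp
  have "blinfun_apply f y = 0" if "0 \<preceq> y" "y \<preceq> char_seq A" for y
  proof (rule vanishing_on_subindicators[OF _ _ _ that])
    show "linear (blinfun_apply f)"
      by (rule bounded_linear.linear[OF blinfun.bounded_linear_right])
    show "\<bar>blinfun_apply f x\<bar> \<le> norm x * norm f" for x
      using norm_blinfun[of f x] by (simp add: mult.commute)
    show "blinfun_apply f (char_seq C) = 0" if "C \<subseteq> A" for C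
    proof (rule null)
      show "C \<in> I" using that A I unfolding ideal_on_nat_def by blast
    qed
  qed
  then have "cone_sup f (char_seq A) \<le> 0"
    by (intro cone_sup_least[OF nonneg]) simp
  then show ?thesis
    using cone_sup_nonneg[OF nonneg, of f] by (simp add: pos_part_eq_cone_sup[OF nonneg])
qed

section \<open>Decompositions\<close>

text \<open>Both parts of \<open>f\<close> have the value \<open>\<parallel>f\<parallel> / 2\<close> at the unit; the multiple of \<open>s\<close> supplies the
  missing mass \<open>1 - \<parallel>f\<parallel> / 2\<close>, which is nonnegative exactly when \<open>\<parallel>f\<parallel> \<le> 2\<close>.\<close>

lemma decomposition_by_filling:
  assumes I: "ideal_on_nat I" and f0: "blinfun_apply f unit_seq = 0" and f2: "norm f \<le> 2"
    and null: "\<And>A. A \<in> I \<Longrightarrow> blinfun_apply f (char_seq A) = 0"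
    and s: "s \<in> SL I"
  shows "(\<lambda>x. pos_part f x + (1 - norm f / 2) * s x) \<in> SL I" (is "?g \<in> _")
    and "(\<lambda>x. pos_part f x - blinfun_apply f x + (1 - norm f / 2) * s x) \<in> SL I" (is "?h \<in> _")
proof -
  have combine: "positive_linear (\<lambda>x. p x + c * s x)" if "positive_linear p" "c \<ge> 0" for p c
    using that SL_positive_linear[OF s]
    by (auto simp: positive_linear_def intro!: linearI simp: linear_add linear_scale algebra_simps)
  have c: "0 \<le> 1 - norm f / 2" using f2 by simp
  show "?g \<in> SL I"
    by (rule positive_linear_in_SL[OF I combine[OF pos_part_positive_linear c]])
      (simp_all add: norm_eq_pos_part[OF f0] SL_unit[OF s] SL_null[OF s] pos_part_null[OF I null])
  show "?h \<in> SL I"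
    by (rule positive_linear_in_SL[OF I combine[OF neg_part_positive_linear c]])
      (simp_all add: norm_eq_pos_part[OF f0] f0 null SL_unit[OF s] SL_null[OF s]
        pos_part_null[OF I null])
qed

lemma SL_difference_necessary:
  assumes g: "g \<in> SL I" and h: "h \<in> SL I" and f: "\<And>x. blinfun_apply f x = g x - h x"
  shows "blinfun_apply f unit_seq = 0" "norm f \<le> 2"
    "\<And>A. A \<in> I \<Longrightarrow> blinfun_apply f (char_seq A) = 0"
proof -
  show "blinfun_apply f unit_seq = 0"
    by (simp add: f SL_unit[OF g] SL_unit[OF h])
  show "norm f \<le> 2"
  proof (rule norm_blinfun_bound)
    show "norm (blinfun_apply f x) \<le> 2 * norm x" for x
      using positive_linear_abs_le[OF SL_positive_linear[OF g], of x]
        positive_linear_abs_le[OF SL_positive_linear[OF h], of x]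
      by (simp add: f SL_unit[OF g] SL_unit[OF h])
  qed simp
  show "\<And>A. A \<in> I \<Longrightarrow> blinfun_apply f (char_seq A) = 0"
    by (simp add: f SL_null[OF g] SL_null[OF h])
qed

text \<open>The functional \<open>g - f\<^sup>+\<close> is positive, and its value at the unit is \<open>1 - \<parallel>f\<parallel> / 2 = 0\<close>.\<close>

lemma decomposition_norm_two:
  assumes g: "g \<in> SL I" and h: "h \<in> SL I" and f: "\<And>x. blinfun_apply f x = g x - h x"
    and f2: "norm f = 2"
  shows "g = pos_part f"
proof
  fix x
  have "positive_linear (\<lambda>x. g x - pos_part f x)"
    using SL_positive_linear[OF g] pos_part_positive_linear[of f]
      pos_part_le[OF SL_positive_linear[OF g] SL_positive_linear[OF h] f]
    by (auto simp: positive_linear_def intro: linear_compose_sub)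
  from positive_linear_abs_le[OF this, of x]
  have "\<bar>g x - pos_part f x\<bar> \<le> norm x * (1 - norm f / 2)"
    using norm_eq_pos_part[OF SL_difference_necessary(1)[OF g h f]] by (simp add: SL_unit[OF g])
  then show "g x = pos_part f x" using f2 by simp
qed

theorem theorem2p5:
  fixes I :: "nat set set" and f :: ell_infty_dual
  assumes "ideal_on_nat I"
  shows "((\<exists>g\<in>SL I. \<exists>h\<in>SL I. \<forall>x. blinfun_apply f x = g x - h x) \<longleftrightarrow>
            blinfun_apply f (const_bcontfun 1) = 0 \<and>
            norm f \<le> 2 \<and>
            (\<forall>A\<in>I. blinfun_apply f (char_seq A) = 0)) \<and>
         (blinfun_apply f (const_bcontfun 1) = 0 \<and>
            norm f \<le> 2 \<and>
            (\<forall>A\<in>I. blinfun_apply f (char_seq A) = 0) \<longrightarrow>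
          ((\<exists>!(g, h). g \<in> SL I \<and> h \<in> SL I \<and> (\<forall>x. blinfun_apply f x = g x - h x)) \<longleftrightarrow>
            norm f = 2 \<or> maximal_ideal_on_nat I))"
    (is "(?D \<longleftrightarrow> ?C) \<and> (?C \<longrightarrow> (?U \<longleftrightarrow> ?M))")
proof -
  let ?dec = "\<lambda>g h. g \<in> SL I \<and> h \<in> SL I \<and> (\<forall>x. blinfun_apply f x = g x - h x)"
  define G where "G s = (\<lambda>x. pos_part f x + (1 - norm f / 2) * s x)" for s
  define H where "H s = (\<lambda>x. pos_part f x - blinfun_apply f x + (1 - norm f / 2) * s x)" for s
  have dec: "?dec (G s) (H s)" if ?C "s \<in> SL I" for s
    using decomposition_by_filling[OF assms, of f s] that by (simp add: G_def H_def)
  have "UNIV \<notin> I" using assms by (simp add: ideal_on_nat_def)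
  then obtain s where s: "s \<in> SL I"
    using SL_with_value_one[OF assms] by blast
  have "?D \<longleftrightarrow> ?C"
    using SL_difference_necessary dec[OF _ s] by metis
  moreover have "?U \<longleftrightarrow> ?M" if C: ?C
  proof
    assume U: ?U
    show ?M
    proof (rule ccontr)
      assume M: "\<not> ?M"
      obtain t u where tu: "t \<in> SL I" "u \<in> SL I" "t \<noteq> u"
        using SL_not_maximal_two[OF assms] M by blast
      have "(G t, H t) = (G u, H u)"
        using U dec[OF C tu(1)] dec[OF C tu(2)] by (blast dest: alt_ex1E)
      then have "(1 - norm f / 2) * t x = (1 - norm f / 2) * u x" for x
        unfolding G_def by (metis (mono_tags) Pair_inject add_left_cancel)
      moreover have "1 - norm f / 2 \<noteq> 0" using M by auto
      ultimately have "t = u" by auto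
      with tu show False by simp
    qed
  next
    assume M: ?M
    have "g = g'" if "?dec g h" "?dec g' h'" for g h g' h'
      using M
    proof
      assume "norm f = 2"
      then have "g = pos_part f" "g' = pos_part f"
        using that decomposition_norm_two by blast+
      then show ?thesis by simp
    qed (use that SL_maximal_unique in blast)
    moreover have "h = h'" if "?dec g h" "?dec g h'" for g h h'
    proof
      fix x
      have "g x - h x = g x - h' x" using that by metis
      then show "h x = h' x" by simp
    qed
    ultimately have "g = G s \<and> h = H s" if "?dec g h" for g h
      using that dec[OF C s] by blast
    then show ?U
      using dec[OF C s] by (intro ex1I[of _ "(G s, H s)"]) (simp, blast)
  qed
  ultimately show ?thesis by blast
qed

end
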